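(* Let $\mathcal{M}=\{\mathbf{M}^{(\lambda)}:\lambda>0\}$ and $\mathcal{N}=\{\mathbf{N}^{(\lambda)}:\lambda>0\}$ be arbitrary weight matrices (of sequences indexed by $\mathbb{N}_0^d$) and consider the following assertions: (i) $\mathcal{M}(\preceq)\mathcal{N}$; (ii) $\mathcal{S}_{(\mathcal{M})}(\mathbb{R}^d)\subseteq\mathcal{S}_{(\mathcal{N})}(\mathbb{R}^d)$ is valid with continuous inclusion. Then (i)$\Rightarrow$(ii), and the spaces in (ii) can be defined by joint or separated growth at infinity. If both matrices are standard log-convex, $\mathcal{M}$ is Beurling non-quasianalytic and satisfies $$\forall\lambda>0\ \exists\kappa>0\ \exists A\ge 1\ \forall p\in\mathbb{N}_0:\quad (M^{(\kappa)}_p)^2\le A^pM^{(\lambda)}_p,$$ and if (ii) holds for the case $d=1$, then (ii)$\Rightarrow$(i) is valid, too.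
   Context: $\mathbb{N}_0=\mathbb{N}\cup\{0\}$. A weight matrix is a family $\mathcal{M}=(\mathbf{M}^{(\lambda)})_{\lambda>0}$ of sequences $\mathbf{M}^{(\lambda)}=(M^{(\lambda)}_\alpha)_{\alpha\in\mathbb{N}_0^d}$ of positive reals with $M^{(\lambda)}_0=1$ and $M^{(\lambda)}_\alpha\le M^{(\kappa)}_\alpha$ for all $\alpha$ whenever $0<\lambda\le\kappa$. For $d=1$ it is standard log-convex if each $\mathbf{M}^{(\lambda)}\in\mathcal{LC}$, where $\mathcal{LC}$ is the set of positive sequences $(M_p)_{p\in\mathbb{N}_0}$ with $M_1\ge M_0=1$, $M_p^2\le M_{p-1}M_{p+1}$ for $p\ge 1$, and $\lim_{p\to\infty}(M_p)^{1/p}=\infty$. A sequence $\mathbf{M}\in\mathcal{LC}$ is non-quasianalytic if $\sum_{k\ge 1}M_{k-1}/M_k<\infty$; a standard log-convex matrix $\mathcal{M}$ is Beurling non-quasianalytic if $\mathbf{M}^{(\lambda)}$ is non-quasianalytic for all $\lambda>0$. $\mathbf{M}\preceq\mathbf{N}$ means: there is $C\ge 1$ with $M_\alpha\le C^{|\alpha|}N_\alpha$ for all $\alpha$. $\mathcal{M}(\preceq)\mathcal{N}$ means: $\forall\lambda>0\ \exists\kappa>0:\ \mathbf{M}^{(\kappa)}\preceq\mathbf{N}^{(\lambda)}$. $\mathcal{S}_{(\mathcal{M})}(\mathbb{R}^d)$ is the space of all $f\in C^\infty(\mathbb{R}^d)$ with $\sup_{\alpha,\beta\in\mathbb{N}_0^d}\frac{\|x^\alpha\partial^\beta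 f\|_\infty}{h^{|\alpha+\beta|}M^{(\lambda)}_{\alpha+\beta}}<\infty$ for all $\lambda,h>0$, with the projective limit topology given by these seminorms ($\|\cdot\|_\infty$ is the supremum norm on $\mathbb{R}^d$). This is the definition by joint growth at infinity; in the definition by separated growth at infinity, $M^{(\lambda)}_{\alpha+\beta}$ is replaced by $M^{(\lambda)}_\alpha M^{(\lambda)}_\beta$. *)

theory Defs
  imports "HOL-Analysis.Analysis"
begin

section \<open>Multi-indices, partial derivatives, smooth functions\<close>

definition mi_abs :: "nat ^ 'd \<Rightarrow> nat" where
  "mi_abs \<alpha> = (\<Sum>i\<in>UNIV. \<alpha> $ i)"

definition monomial :: "nat ^ 'd \<Rightarrow> real ^ 'd \<Rightarrow> real" where
  "monomial \<alpha> x = (\<Prod>i\<in>UNIV. (x $ i) ^ (\<alpha> $ i))"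

definition has_partial :: "'d \<Rightarrow> (real ^ 'd \<Rightarrow> complex) \<Rightarrow> real ^ 'd \<Rightarrow> bool" where
  "has_partial i f x \<longleftrightarrow> (\<lambda>t. f (x + t *\<^sub>R axis i 1)) differentiable (at (0::real))"

definition partial :: "'d \<Rightarrow> (real ^ 'd \<Rightarrow> complex) \<Rightarrow> real ^ 'd \<Rightarrow> complex" where
  "partial i f x = vector_derivative (\<lambda>t. f (x + t *\<^sub>R axis i 1)) (at (0::real))"

primrec C_k :: "nat \<Rightarrow> (real ^ 'd \<Rightarrow> complex) \<Rightarrow> bool" where
  "C_k 0 f \<longleftrightarrow> continuous_on UNIV f"
| "C_k (Suc k) f \<longleftrightarrow> continuous_on UNIV f \<and> (\<forall>i. (\<forall>x. has_partial i f x) \<and> C_k k (partial i f))"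

definition smooth :: "(real ^ 'd \<Rightarrow> complex) \<Rightarrow> bool" where
  "smooth f \<longleftrightarrow> (\<forall>k. C_k k f)"

text \<open>The partial derivative for the multi-index \<open>\<beta>\<close>: differentiate successively along some list
  of coordinates in which each \<open>i\<close> occurs \<open>\<beta> $ i\<close> times. The index type carries no order, hence the
  choice; on smooth functions the order is irrelevant by Schwarz's theorem.\<close>

definition multi_partial :: "nat ^ 'd \<Rightarrow> (real ^ 'd \<Rightarrow> complex) \<Rightarrow> real ^ 'd \<Rightarrow> complex" where
  "multi_partial \<beta> f = foldr partial (SOME is. \<forall>i. count_list is i = \<beta> $ i) f"

lemma ex_count_list_multi_index:
  fixes \<beta> :: "nat ^ 'd"
  shows "\<exists>is. \<forall>i. count_list is i = \<beta> $ i"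
proof -
  define m where "m = (\<Sum>i\<in>UNIV. replicate_mset (\<beta> $ i) i)"
  obtain xs where xs: "mset xs = m" using ex_mset by blast
  have "count_list xs i = \<beta> $ i" for i
    unfolding count_mset[symmetric] xs m_def by (simp add: count_sum)
  then show ?thesis by blast
qed

section \<open>Weight matrices\<close>

definition weight_matrix :: "(real \<Rightarrow> nat ^ 'd \<Rightarrow> real) \<Rightarrow> bool" where
  "weight_matrix M \<longleftrightarrow>
     (\<forall>\<mu>>0. (\<forall>\<alpha>. 0 < M \<mu> \<alpha>) \<and> M \<mu> 0 = 1) \<and>
     (\<forall>\<mu> \<kappa> \<alpha>. 0 < \<mu> \<and> \<mu> \<le> \<kappa> \<longrightarrow> M \<mu> \<alpha> \<le> M \<kappa> \<alpha>)"

definition seq_preceq :: "(nat ^ 'd \<Rightarrow> real) \<Rightarrow> (nat ^ 'd \<Rightarrow> real) \<Rightarrow> bool" where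
  "seq_preceq M N \<longleftrightarrow> (\<exists>C\<ge>1. \<forall>\<alpha>. M \<alpha> \<le> C ^ mi_abs \<alpha> * N \<alpha>)"

definition beurling_preceq ::
  "(real \<Rightarrow> nat ^ 'd \<Rightarrow> real) \<Rightarrow> (real \<Rightarrow> nat ^ 'd \<Rightarrow> real) \<Rightarrow> bool" where
  "beurling_preceq M N \<longleftrightarrow> (\<forall>\<mu>>0. \<exists>\<kappa>>0. seq_preceq (M \<kappa>) (N \<mu>))"

text \<open>For \<open>d = 1\<close>, that is \<open>CARD('d) = 1\<close>, every multi-index has the form \<open>vec p\<close>; this is the
  identification of families indexed by one-component multi-indices with sequences on \<open>nat\<close>.\<close>

definition as_sequences :: "(real \<Rightarrow> nat ^ 'd \<Rightarrow> real) \<Rightarrow> real \<Rightarrow> nat \<Rightarrow> real" where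
  "as_sequences M \<mu> p = M \<mu> (vec p)"

definition LC :: "(nat \<Rightarrow> real) set" where
  "LC = {M. (\<forall>p. 0 < M p) \<and> M 0 = 1 \<and> M 1 \<ge> 1 \<and>
            (\<forall>p\<ge>1. (M p)\<^sup>2 \<le> M (p - 1) * M (p + 1)) \<and>
            filterlim (\<lambda>p. M p powr (1 / real p)) at_top sequentially}"

definition standard_log_convex :: "(real \<Rightarrow> nat \<Rightarrow> real) \<Rightarrow> bool" where
  "standard_log_convex M \<longleftrightarrow> (\<forall>\<mu>>0. M \<mu> \<in> LC)"

definition non_quasianalytic :: "(nat \<Rightarrow> real) \<Rightarrow> bool" where
  "non_quasianalytic M \<longleftrightarrow> summable (\<lambda>k. M k / M (Suc k))"

definition beurling_non_quasianalytic :: "(real \<Rightarrow> nat \<Rightarrow> real) \<Rightarrow> bool" where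
  "beurling_non_quasianalytic M \<longleftrightarrow> (\<forall>\<mu>>0. non_quasianalytic (M \<mu>))"

section \<open>Beurling type spaces of rapidly decreasing ultradifferentiable functions\<close>

text \<open>The two ways of measuring growth at infinity differ only in the weight attached to a pair
  \<open>(\<alpha>, \<beta>)\<close>, so seminorms, spaces and topologies take a family \<open>W\<close> of such weights.\<close>

definition joint_growth ::
  "(real \<Rightarrow> nat ^ 'd \<Rightarrow> real) \<Rightarrow> real \<Rightarrow> nat ^ 'd \<Rightarrow> nat ^ 'd \<Rightarrow> real" where
  "joint_growth M \<mu> \<alpha> \<beta> = M \<mu> (\<alpha> + \<beta>)"

definition separated_growth ::
  "(real \<Rightarrow> nat ^ 'd \<Rightarrow> real) \<Rightarrow> real \<Rightarrow> nat ^ 'd \<Rightarrow> nat ^ 'd \<Rightarrow> real" where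
  "separated_growth M \<mu> \<alpha> \<beta> = M \<mu> \<alpha> * M \<mu> \<beta>"

definition sup_norm :: "(real ^ 'd \<Rightarrow> complex) \<Rightarrow> ennreal" where
  "sup_norm g = (SUP x. ennreal (norm (g x)))"

text \<open>The values lie in \<open>ennreal\<close> so that the suprema are genuine even when infinite.\<close>

definition S_seminorm ::
  "(nat ^ 'd \<Rightarrow> nat ^ 'd \<Rightarrow> real) \<Rightarrow> real \<Rightarrow> (real ^ 'd \<Rightarrow> complex) \<Rightarrow> ennreal" where
  "S_seminorm w h f =
     (SUP (\<alpha>, \<beta>). sup_norm (\<lambda>x. of_real (monomial \<alpha> x) * multi_partial \<beta> f x)
                    / ennreal (h ^ mi_abs (\<alpha> + \<beta>) * w \<alpha> \<beta>))"

definition S_space ::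
  "(real \<Rightarrow> nat ^ 'd \<Rightarrow> nat ^ 'd \<Rightarrow> real) \<Rightarrow> (real ^ 'd \<Rightarrow> complex) set" where
  "S_space W = {f. smooth f \<and> (\<forall>\<mu>>0. \<forall>h>0. S_seminorm (W \<mu>) h f < \<infinity>)}"

text \<open>The locally convex topology of the family of seminorms, with the open seminorm balls as
  subbasis.\<close>

definition S_topology ::
  "(real \<Rightarrow> nat ^ 'd \<Rightarrow> nat ^ 'd \<Rightarrow> real) \<Rightarrow> (real ^ 'd \<Rightarrow> complex) topology" where
  "S_topology W = topology_generated_by
     {{g \<in> S_space W. S_seminorm (W \<mu>) h (\<lambda>x. g x - f x) < \<epsilon>} | f \<mu> h \<epsilon>.
        f \<in> S_space W \<and> 0 < \<mu> \<and> 0 < h \<and> 0 < \<epsilon>}"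

definition continuously_included ::
  "(real \<Rightarrow> nat ^ 'd \<Rightarrow> nat ^ 'd \<Rightarrow> real) \<Rightarrow> (real \<Rightarrow> nat ^ 'd \<Rightarrow> nat ^ 'd \<Rightarrow> real) \<Rightarrow> bool" where
  "continuously_included V W \<longleftrightarrow>
     S_space V \<subseteq> S_space W \<and> continuous_map (S_topology V) (S_topology W) id"

lemma S_seminorm_zero:
  fixes w :: "nat ^ 'd \<Rightarrow> nat ^ 'd \<Rightarrow> real"
  shows "S_seminorm w h (\<lambda>x. 0) = 0"
proof -
  have p: "partial i (\<lambda>x. 0) = (\<lambda>x. 0)" for i :: 'd
    by (rule ext) (simp add: partial_def)
  have "foldr partial is (\<lambda>x. 0) = (\<lambda>x. 0)" for "is" :: "'d list"
    by (induction "is") (auto simp: p)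
  then have "multi_partial \<beta> (\<lambda>x. 0) = (\<lambda>x. 0)" for \<beta> :: "nat ^ 'd"
    unfolding multi_partial_def by blast
  moreover have "sup_norm (\<lambda>x :: real ^ 'd. 0) = 0"
    by (simp add: sup_norm_def)
  ultimately show ?thesis
    unfolding S_seminorm_def by (simp add: case_prod_unfold)
qed

lemma topspace_S_topology: "topspace (S_topology W) = S_space W"
proof
  show "topspace (S_topology W) \<subseteq> S_space W"
    unfolding S_topology_def topology_generated_by_topspace by blast
  show "S_space W \<subseteq> topspace (S_topology W)"
  proof
    fix f assume f: "f \<in> S_space W"
    define U where "U = {g \<in> S_space W. S_seminorm (W 1) 1 (\<lambda>x. g x - f x) < 1}"
    have "f \<in> U"
      using f by (simp add: U_def S_seminorm_zero)
    moreover have "openin (S_topology W) U"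
      unfolding S_topology_def U_def using f
      by (intro topology_generated_by_Basis CollectI exI conjI) (rule refl | assumption | simp)+
    ultimately show "f \<in> topspace (S_topology W)"
      using openin_subset by blast
  qed
qed

end

theory Submission
  imports Defs
begin

text \<open>
  If \<open>M \<kappa> \<alpha> \<le> C ^ |\<alpha>| * N \<mu> \<alpha>\<close>, then the seminorm with parameters \<open>\<mu>\<close>, \<open>h\<close> for \<open>N\<close> is at most the
  one with parameters \<open>\<kappa>\<close>, \<open>h / C\<close> for \<open>M\<close>, for either kind of growth. Domination of each seminorm
  of the target by one seminorm of the source gives a continuous inclusion.

  For the converse in one variable, continuity at \<open>0\<close> provides, for given \<open>\<mu>\<close>, a seminorm of the
  space for \<open>M\<close>, say with parameters \<open>\<kappa>\<close> and \<open>h\<close>, whose \<open>\<delta>\<close>-ball lies in the unit ball of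
  the seminorm with parameters \<open>\<mu>\<close>, \<open>1\<close> for \<open>N\<close>. It is tested on scaled modulated Gaussians
  \<open>exp (itx - x\<^sup>2/2)\<close> with real frequency \<open>t\<close>, for which three facts are needed.

  \<^item> \<^bold>\<open>They belong to the space for \<open>M\<close>.\<close> In a log-convex non-quasianalytic sequence the terms
    \<open>L k / L (k + 1)\<close> decrease and have a finite sum, so \<open>L p\<close> dominates \<open>p!\<close> up to a geometric factor;
    the squaring condition improves this to \<open>(p!)\<^sup>2 \<le> b ^ p * M \<kappa> p\<close> for every \<open>\<kappa>\<close>. Compared with this,
    the elementary Gaussian bound \<open>|x ^ a * (D ^ n g) x| \<le> const * 2 ^ n * (a + n)!\<close> is negligible.

  \<^item> \<^bold>\<open>Upper bound.\<close> Their \<open>(\<kappa>, h)\<close>-seminorm is at most \<open>K T\<close>, where \<open>K\<close> does not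
    depend on \<open>t\<close>, and \<open>T\<close> is any bound for all \<open>t ^ j / ((h/2) ^ j * M \<kappa> j)\<close>
    (lemma \<open>wave_packet_bound\<close>).

  \<^item> \<^bold>\<open>Lower bound.\<close> At the origin all terms of the \<open>p\<close>-th derivative have the same phase \<open>\<i> ^ p\<close>, so
    it is at least \<open>t ^ p\<close> in modulus (lemma \<open>wave_packet_at_0_ge\<close>).

  Hence \<open>t ^ p / T \<le> const * N \<mu> p\<close>. For \<open>p \<ge> 1\<close> take \<open>t = (h/2) * M \<kappa> p / M \<kappa> (p - 1)\<close>. By log-convexity
  the supremum defining the best \<open>T\<close> is then attained at \<open>j = p\<close> (lemma \<open>LC_supporting_line\<close>), so that
  \<open>t ^ p / T = (h/2) ^ p * M \<kappa> p\<close>, which is the asserted comparison.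
\<close>

section \<open>Smooth functions and the seminorms\<close>

lemma smooth_partial: "smooth f \<Longrightarrow> smooth (partial i f)"
  unfolding smooth_def by (metis C_k.simps(2))

lemma smooth_has_partial: "smooth f \<Longrightarrow> has_partial i f x"
  unfolding smooth_def by (metis C_k.simps(2))

lemma smooth_zero: "smooth (\<lambda>x :: real ^ 'd. 0)"
proof -
  have p: "partial i (\<lambda>x. 0) = (\<lambda>x. 0)" for i :: 'd
    by (rule ext) (simp add: partial_def)
  have "C_k k (\<lambda>x :: real ^ 'd. 0)" for k
    by (induction k) (auto simp: p has_partial_def)
  then show ?thesis by (simp add: smooth_def)
qed

lemma partial_diff:
  assumes "smooth f" "smooth g"
  shows "partial i (\<lambda>x. f x - g x) = (\<lambda>x. partial i f x - partial i g x)"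
proof
  fix x
  show "partial i (\<lambda>x. f x - g x) x = partial i f x - partial i g x"
    using smooth_has_partial[OF assms(1), of i x] smooth_has_partial[OF assms(2), of i x]
    unfolding partial_def has_partial_def by (rule vector_derivative_diff_at)
qed

text \<open>Smoothness matters here: \<^const>\<open>partial\<close> is an arbitrary value where the partial derivative
  fails to exist, and is additive only on functions that possess it.\<close>
lemma multi_partial_diff:
  assumes "smooth f" "smooth g"
  shows "multi_partial \<beta> (\<lambda>x. f x - g x) = (\<lambda>x. multi_partial \<beta> f x - multi_partial \<beta> g x)"
proof -
  have smooth_foldr: "smooth (foldr partial is f)" if "smooth f" for "is" and f :: "real ^ 'a \<Rightarrow> complex"
    using that by (induction "is") (auto intro: smooth_partial)
  have "foldr partial is (\<lambda>x. f x - g x) = (\<lambda>x. foldr partial is f x - foldr partial is g x)" for "is"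
    by (induction "is") (simp_all add: partial_diff smooth_foldr assms)
  then show ?thesis unfolding multi_partial_def by blast
qed

lemma S_seminorm_diff_triangle:
  assumes "smooth f" "smooth g" "smooth u"
  shows "S_seminorm w h (\<lambda>x. f x - u x)
    \<le> S_seminorm w h (\<lambda>x. f x - g x) + S_seminorm w h (\<lambda>x. g x - u x)"
proof -
  let ?q = "\<lambda>\<alpha> \<beta> f. sup_norm (\<lambda>x. of_real (monomial \<alpha> x) * multi_partial \<beta> f x)"
  let ?s = "\<lambda>f \<alpha> \<beta>. ?q \<alpha> \<beta> f / ennreal (h ^ mi_abs (\<alpha> + \<beta>) * w \<alpha> \<beta>)"
  have upper: "?s v \<alpha> \<beta> \<le> S_seminorm w h v" for v \<alpha> \<beta>
    unfolding S_seminorm_def by (rule SUP_upper2[of "(\<alpha>, \<beta>)"]) auto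
  have tri: "?q \<alpha> \<beta> (\<lambda>x. f x - u x) \<le> ?q \<alpha> \<beta> (\<lambda>x. f x - g x) + ?q \<alpha> \<beta> (\<lambda>x. g x - u x)" for \<alpha> \<beta>
    unfolding sup_norm_def
  proof (rule SUP_least)
    fix x
    let ?m = "complex_of_real (monomial \<alpha> x)"
    have "ennreal (norm (?m * multi_partial \<beta> (\<lambda>x. f x - u x) x))
        \<le> ennreal (norm (?m * multi_partial \<beta> (\<lambda>x. f x - g x) x)
           + norm (?m * multi_partial \<beta> (\<lambda>x. g x - u x) x))"
      unfolding multi_partial_diff[OF assms(1,3)] multi_partial_diff[OF assms(1,2)]
        multi_partial_diff[OF assms(2,3)]
      by (intro ennreal_leI order_trans[OF _ norm_triangle_ineq]) (simp add: algebra_simps)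
    also have "\<dots> = ennreal (norm (?m * multi_partial \<beta> (\<lambda>x. f x - g x) x))
           + ennreal (norm (?m * multi_partial \<beta> (\<lambda>x. g x - u x) x))"
      by (rule ennreal_plus) auto
    also have "\<dots> \<le> (SUP x. ennreal (norm (complex_of_real (monomial \<alpha> x) * multi_partial \<beta> (\<lambda>x. f x - g x) x)))
        + (SUP x. ennreal (norm (complex_of_real (monomial \<alpha> x) * multi_partial \<beta> (\<lambda>x. g x - u x) x)))"
      by (intro add_mono SUP_upper2[of x]) auto
    finally show "ennreal (norm (?m * multi_partial \<beta> (\<lambda>x. f x - u x) x)) \<le> \<dots>" .
  qed
  have "?s (\<lambda>x. f x - u x) \<alpha> \<beta> \<le> S_seminorm w h (\<lambda>x. f x - g x) + S_seminorm w h (\<lambda>x. g x - u x)"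
    for \<alpha> \<beta>
  proof -
    have "?s (\<lambda>x. f x - u x) \<alpha> \<beta> \<le> ?s (\<lambda>x. f x - g x) \<alpha> \<beta> + ?s (\<lambda>x. g x - u x) \<alpha> \<beta>"
      unfolding add_divide_distrib_ennreal[symmetric] by (rule divide_right_mono_ennreal[OF tri])
    also have "\<dots> \<le> S_seminorm w h (\<lambda>x. f x - g x) + S_seminorm w h (\<lambda>x. g x - u x)"
      by (intro add_mono upper)
    finally show ?thesis .
  qed
  then show ?thesis
    by (subst S_seminorm_def) (auto intro!: SUP_least)
qed

lemma S_seminorm_le_iff:
  assumes "0 < h" "\<And>\<alpha> \<beta>. 0 < w \<alpha> \<beta>" "0 \<le> X"
  shows "S_seminorm w h f \<le> ennreal X \<longleftrightarrow>
    (\<forall>\<alpha> \<beta> x. \<bar>monomial \<alpha> x\<bar> * norm (multi_partial \<beta> f x) \<le> X * (h ^ mi_abs (\<alpha> + \<beta>) * w \<alpha> \<beta>))"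
proof -
  have *: "s / ennreal y \<le> ennreal X \<longleftrightarrow> s \<le> ennreal (X * y)" if y: "0 < y" for s y
  proof
    assume "s / ennreal y \<le> ennreal X"
    then have "s / ennreal y * ennreal y \<le> ennreal X * ennreal y"
      by (intro mult_right_mono) auto
    then show "s \<le> ennreal (X * y)"
      using y assms(3) by (simp add: ennreal_divide_times ennreal_mult')
  next
    assume "s \<le> ennreal (X * y)"
    then have "s / ennreal y \<le> ennreal (X * y) / ennreal y"
      by (rule divide_right_mono_ennreal)
    then show "s / ennreal y \<le> ennreal X"
      using y assms(3) by (simp add: divide_ennreal)
  qed
  have pos: "0 < h ^ mi_abs (\<alpha> + \<beta>) * w \<alpha> \<beta>" for \<alpha> \<beta>
    using assms by simp
  show ?thesis
    unfolding S_seminorm_def SUP_le_iff split_paired_all Ball_def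
    using assms(3) pos
    by (auto simp: * sup_norm_def SUP_le_iff norm_mult ennreal_le_iff less_imp_le)
qed

lemma ennreal_inverse_antimono: "x \<le> y \<Longrightarrow> inverse y \<le> inverse (x :: ennreal)"
  unfolding less_eq_ennreal.rep_eq inverse_ennreal.rep_eq
  by (intro ereal_inverse_antimono) auto

text \<open>The parameters \<open>h\<close> and \<open>w\<close> enter only through the products \<open>h ^ |\<alpha> + \<beta>| * w \<alpha> \<beta>\<close>. This one comparison
  yields both the monotonicity in the parameters and the effect of the relation between the matrices.\<close>
lemma S_seminorm_weight_mono:
  assumes "\<And>\<alpha> \<beta>. k ^ mi_abs (\<alpha> + \<beta>) * v \<alpha> \<beta> \<le> h ^ mi_abs (\<alpha> + \<beta>) * w \<alpha> \<beta>"
  shows "S_seminorm w h f \<le> S_seminorm v k f"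
  unfolding S_seminorm_def
proof (rule SUP_mono, clarify)
  fix \<alpha> \<beta>
  have "inverse (ennreal (h ^ mi_abs (\<alpha> + \<beta>) * w \<alpha> \<beta>)) \<le> inverse (ennreal (k ^ mi_abs (\<alpha> + \<beta>) * v \<alpha> \<beta>))"
    by (rule ennreal_inverse_antimono[OF ennreal_leI[OF assms]])
  then show "\<exists>m\<in>UNIV. sup_norm (\<lambda>x. of_real (monomial \<alpha> x) * multi_partial \<beta> f x) /
        ennreal (h ^ mi_abs (\<alpha> + \<beta>) * w \<alpha> \<beta>)
     \<le> (case m of (\<alpha>, \<beta>) \<Rightarrow> sup_norm (\<lambda>x. of_real (monomial \<alpha> x) * multi_partial \<beta> f x) /
        ennreal (k ^ mi_abs (\<alpha> + \<beta>) * v \<alpha> \<beta>))"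
    by (intro bexI[of _ "(\<alpha>, \<beta>)"]) (auto simp: divide_ennreal_def intro!: mult_left_mono)
qed

section \<open>Neighbourhoods and continuous inclusions\<close>

definition increasing_weights :: "(real \<Rightarrow> nat ^ 'd \<Rightarrow> nat ^ 'd \<Rightarrow> real) \<Rightarrow> bool" where
  "increasing_weights W \<longleftrightarrow> (\<forall>\<mu>>0. \<forall>\<alpha> \<beta>. 0 < W \<mu> \<alpha> \<beta>) \<and>
     (\<forall>\<mu> \<kappa> \<alpha> \<beta>. 0 < \<mu> \<and> \<mu> \<le> \<kappa> \<longrightarrow> W \<mu> \<alpha> \<beta> \<le> W \<kappa> \<alpha> \<beta>)"

lemma S_seminorm_antimono_parameters:
  assumes "increasing_weights W" "0 < \<mu>" "\<mu> \<le> \<kappa>" "0 < k" "k \<le> h"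
  shows "S_seminorm (W \<kappa>) h f \<le> S_seminorm (W \<mu>) k f"
proof (rule S_seminorm_weight_mono)
  fix \<alpha> \<beta> :: "nat ^ 'a"
  show "k ^ mi_abs (\<alpha> + \<beta>) * W \<mu> \<alpha> \<beta> \<le> h ^ mi_abs (\<alpha> + \<beta>) * W \<kappa> \<alpha> \<beta>"
    using assms unfolding increasing_weights_def
    by (intro mult_mono power_mono) (auto intro: less_imp_le)
qed

text \<open>The centre \<open>f\<close> is only assumed smooth: in the inclusion of one space into another it may lie
  in the larger space alone. The radius is the slack \<open>\<epsilon> - q(g - f)\<close> in the triangle inequality.\<close>
lemma ball_in_ball:
  assumes "smooth f" "smooth g" "S_seminorm w h (\<lambda>x. g x - f x) < \<epsilon>"
  shows "\<exists>\<delta>>0. \<forall>u. smooth u \<and> S_seminorm w h (\<lambda>x. u x - g x) < \<delta> \<longrightarrow>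
    S_seminorm w h (\<lambda>x. u x - f x) < \<epsilon>"
proof (intro exI conjI allI impI)
  show "0 < \<epsilon> - S_seminorm w h (\<lambda>x. g x - f x)"
    by (rule diff_gr0_ennreal[OF assms(3)])
  fix u assume u: "smooth u \<and> S_seminorm w h (\<lambda>x. u x - g x) < \<epsilon> - S_seminorm w h (\<lambda>x. g x - f x)"
  then have "S_seminorm w h (\<lambda>x. u x - g x) + S_seminorm w h (\<lambda>x. g x - f x) < \<epsilon>"
    using assms(3) by (subst (asm) less_diff_eq_ennreal) (auto simp: less_top[symmetric])
  then show "S_seminorm w h (\<lambda>x. u x - f x) < \<epsilon>"
    using S_seminorm_diff_triangle[of u g f w h] u assms by (auto intro: le_less_trans)
qed

text \<open>The seminorms are directed, because they increase when \<open>\<mu>\<close> and \<open>h\<close> decrease. So finite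
  intersections of subbasic balls still contain a single ball around each of their points.\<close>
lemma openin_S_topology_ball:
  assumes "increasing_weights W" "openin (S_topology W) U" "f \<in> U"
  shows "\<exists>\<kappa>>0. \<exists>h>0. \<exists>\<delta>>0. {g \<in> S_space W. S_seminorm (W \<kappa>) h (\<lambda>x. g x - f x) < \<delta>} \<subseteq> U"
proof -
  have "generate_topology_on {{g \<in> S_space W. S_seminorm (W \<mu>) h (\<lambda>x. g x - f x) < \<epsilon>} | f \<mu> h \<epsilon>.
        f \<in> S_space W \<and> 0 < \<mu> \<and> 0 < h \<and> 0 < \<epsilon>} U"
    using assms(2) unfolding S_topology_def by (rule openin_topology_generated_by)
  then show ?thesis using assms(3)
  proof induction
    case Empty
    then show ?case by simp
  next
    case (Int A B)
    obtain \<kappa>1 h1 \<delta>1 where 1: "\<kappa>1 > 0" "h1 > 0" "\<delta>1 > 0"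
      "{g \<in> S_space W. S_seminorm (W \<kappa>1) h1 (\<lambda>x. g x - f x) < \<delta>1} \<subseteq> A"
      using Int by blast
    obtain \<kappa>2 h2 \<delta>2 where 2: "\<kappa>2 > 0" "h2 > 0" "\<delta>2 > 0"
      "{g \<in> S_space W. S_seminorm (W \<kappa>2) h2 (\<lambda>x. g x - f x) < \<delta>2} \<subseteq> B"
      using Int by blast
    have le: "S_seminorm (W \<kappa>1) h1 u \<le> S_seminorm (W (min \<kappa>1 \<kappa>2)) (min h1 h2) u"
      "S_seminorm (W \<kappa>2) h2 u \<le> S_seminorm (W (min \<kappa>1 \<kappa>2)) (min h1 h2) u" for u
      using 1 2 by (intro S_seminorm_antimono_parameters[OF assms(1)]; simp)+
    show ?case
      using 1 2
      by (intro exI[of _ "min \<kappa>1 \<kappa>2"] exI[of _ "min h1 h2"] exI[of _ "min \<delta>1 \<delta>2"] conjI)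
         (auto intro: le_less_trans[OF le(1)] le_less_trans[OF le(2)])
  next
    case (UN K)
    then obtain A where A: "A \<in> K" "f \<in> A" by blast
    show ?case using UN.IH[OF A] A(1) by (meson Union_upper subset_trans)
  next
    case (Basis s)
    then obtain u \<mu> h \<epsilon> where s: "s = {g \<in> S_space W. S_seminorm (W \<mu>) h (\<lambda>x. g x - u x) < \<epsilon>}"
      "u \<in> S_space W" "0 < \<mu>" "0 < h" by blast
    have "\<exists>\<delta>>0. \<forall>g. smooth g \<and> S_seminorm (W \<mu>) h (\<lambda>x. g x - f x) < \<delta> \<longrightarrow>
        S_seminorm (W \<mu>) h (\<lambda>x. g x - u x) < \<epsilon>"
      using Basis.prems s(1,2) by (intro ball_in_ball) (auto simp: S_space_def)
    then obtain \<delta> where d: "\<delta> > 0" "\<And>g. smooth g \<Longrightarrow> S_seminorm (W \<mu>) h (\<lambda>x. g x - f x) < \<delta> \<Longrightarrow>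
        S_seminorm (W \<mu>) h (\<lambda>x. g x - u x) < \<epsilon>" by blast
    have "{g \<in> S_space W. S_seminorm (W \<mu>) h (\<lambda>x. g x - f x) < \<delta>} \<subseteq> s"
      using d(2) by (auto simp: s(1) S_space_def)
    then show ?case using s(3,4) d(1) by blast
  qed
qed

lemma continuously_included_if_dominated:
  assumes dom: "\<And>\<mu> h. 0 < \<mu> \<Longrightarrow> 0 < h \<Longrightarrow>
      \<exists>\<kappa>>0. \<exists>k>0. \<forall>f. S_seminorm (W \<mu>) h f \<le> S_seminorm (V \<kappa>) k f"
  shows "continuously_included V W"
proof -
  have sub: "S_space V \<subseteq> S_space W"
    unfolding S_space_def by (clarsimp, meson dom le_less_trans)
  have "openin (S_topology V) {g \<in> S_space V. S_seminorm (W \<mu>) h (\<lambda>x. g x - f x) < \<epsilon>}" (is "openin _ ?U")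
    if f: "f \<in> S_space W" and \<mu>: "0 < \<mu>" and h: "0 < h" for f \<mu> h \<epsilon>
  proof (subst openin_subopen, intro ballI)
    fix g assume g: "g \<in> ?U"
    obtain \<kappa> k where k: "\<kappa> > 0" "k > 0" "\<And>f. S_seminorm (W \<mu>) h f \<le> S_seminorm (V \<kappa>) k f"
      using dom[OF \<mu> h] by blast
    have "\<exists>\<delta>>0. \<forall>u. smooth u \<and> S_seminorm (W \<mu>) h (\<lambda>x. u x - g x) < \<delta> \<longrightarrow>
        S_seminorm (W \<mu>) h (\<lambda>x. u x - f x) < \<epsilon>"
      using f g by (intro ball_in_ball) (auto simp: S_space_def)
    then obtain \<delta> where d: "\<delta> > 0" "\<And>u. smooth u \<Longrightarrow> S_seminorm (W \<mu>) h (\<lambda>x. u x - g x) < \<delta> \<Longrightarrow>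
        S_seminorm (W \<mu>) h (\<lambda>x. u x - f x) < \<epsilon>" by blast
    define B where "B = {u \<in> S_space V. S_seminorm (V \<kappa>) k (\<lambda>x. u x - g x) < \<delta>}"
    have "openin (S_topology V) B"
      unfolding S_topology_def B_def using g k d
      by (intro topology_generated_by_Basis CollectI exI conjI) (rule refl | assumption | simp)+
    moreover have "g \<in> B" using g d by (simp add: B_def S_seminorm_zero)
    moreover have "B \<subseteq> ?U"
      using d(2) le_less_trans[OF k(3)] by (auto simp: B_def S_space_def)
    ultimately show "\<exists>T. openin (S_topology V) T \<and> g \<in> T \<and> T \<subseteq> ?U" by blast
  qed
  note op = this
  have "continuous_map (S_topology V) (S_topology W) id"
    unfolding S_topology_def[of W] continuous_on_generated_topo_iff
  proof (intro conjI allI impI)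
    fix U assume "U \<in> {{g \<in> S_space W. S_seminorm (W \<mu>) h (\<lambda>x. g x - f x) < \<epsilon>} | f \<mu> h \<epsilon>.
        f \<in> S_space W \<and> 0 < \<mu> \<and> 0 < h \<and> 0 < \<epsilon>}"
    then obtain f \<mu> h \<epsilon> where U: "U = {g \<in> S_space W. S_seminorm (W \<mu>) h (\<lambda>x. g x - f x) < \<epsilon>}"
      "f \<in> S_space W" "0 < \<mu>" "0 < h" by blast
    have "id -` U \<inter> topspace (S_topology V) = {g \<in> S_space V. S_seminorm (W \<mu>) h (\<lambda>x. g x - f x) < \<epsilon>}"
      using sub by (auto simp: U(1) topspace_S_topology)
    then show "openin (S_topology V) (id -` U \<inter> topspace (S_topology V))"
      using op[OF U(2-4)] by simp
  next
    show "id ` topspace (S_topology V) \<subseteq> \<Union> {{g \<in> S_space W. S_seminorm (W \<mu>) h (\<lambda>x. g x - f x) < \<epsilon>} | f \<mu> h \<epsilon>.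
        f \<in> S_space W \<and> 0 < \<mu> \<and> 0 < h \<and> 0 < \<epsilon>}"
      using sub topspace_S_topology[of W]
      unfolding S_topology_def[of W] topology_generated_by_topspace topspace_S_topology[of V]
      by simp
  qed
  then show ?thesis using sub by (simp add: continuously_included_def)
qed

text \<open>Continuity at \<open>0\<close>, with a real radius so that functions can be scaled into the ball.\<close>
lemma continuously_included_unit_ball:
  assumes "increasing_weights V" "continuously_included V W" "0 < \<mu>"
  shows "\<exists>\<kappa>>0. \<exists>h>0. \<exists>\<delta>>0. \<forall>f \<in> S_space V.
    S_seminorm (V \<kappa>) h f < ennreal \<delta> \<longrightarrow> S_seminorm (W \<mu>) 1 f < 1"
proof -
  define U where "U = {g \<in> S_space W. S_seminorm (W \<mu>) 1 (\<lambda>x. g x - 0) < 1}"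
  have zero: "(\<lambda>x. 0) \<in> S_space W" for W :: "real \<Rightarrow> nat ^ 'a \<Rightarrow> nat ^ 'a \<Rightarrow> real"
    by (simp add: S_space_def smooth_zero S_seminorm_zero)
  have "openin (S_topology W) U"
    unfolding S_topology_def U_def using zero[of W] assms(3)
    by (intro topology_generated_by_Basis CollectI exI[of _ "\<lambda>x. 0"] exI[of _ \<mu>] exI[of _ 1] conjI)
       (rule refl | assumption | simp)+
  define B where "B = {g \<in> topspace (S_topology V). id g \<in> U}"
  have "openin (S_topology V) B"
    unfolding B_def using assms(2) openin_continuous_map_preimage \<open>openin (S_topology W) U\<close>
    unfolding continuously_included_def by blast
  moreover have "(\<lambda>x. 0) \<in> B"
    using zero by (simp add: B_def topspace_S_topology U_def S_seminorm_zero)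
  ultimately obtain \<kappa> h \<delta> where 1: "\<kappa> > 0" "h > 0" "\<delta> > 0"
    "{g \<in> S_space V. S_seminorm (V \<kappa>) h (\<lambda>x. g x - 0) < \<delta>} \<subseteq> B"
    using openin_S_topology_ball[OF assms(1), of B "\<lambda>x. 0"] by blast
  obtain e where e: "0 < e" "ennreal e < \<delta>"
  proof -
    obtain y where y: "0 < y" "y < \<delta>" using dense[OF 1(3)] by blast
    then obtain e where "y = ennreal e" "0 \<le> e" by (cases y) auto
    then show thesis using y that[of e] by (simp add: ennreal_less_zero_iff)
  qed
  show ?thesis
  proof (intro exI conjI ballI impI)
    show "\<kappa> > 0" "h > 0" "e > 0" using 1 e by auto
    fix f assume "f \<in> S_space V" "S_seminorm (V \<kappa>) h f < ennreal e"
    then have "f \<in> B" using 1(4) e(2) by (auto intro: less_trans)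
    then show "S_seminorm (W \<mu>) 1 f < 1" by (simp add: B_def U_def)
  qed
qed

section \<open>Log-convex sequences\<close>

lemma LC_pos: "L \<in> LC \<Longrightarrow> 0 < L p"
  by (simp add: LC_def)

lemma LC_ratio_mono:
  assumes "L \<in> LC" "p \<le> q"
  shows "L (Suc p) / L p \<le> L (Suc q) / L q"
proof (rule lift_Suc_mono_le[OF _ assms(2)])
  fix n
  have "(L (Suc n))\<^sup>2 \<le> L n * L (Suc (Suc n))"
    using assms(1) unfolding LC_def by (auto dest!: spec[of _ "Suc n"])
  then show "L (Suc n) / L n \<le> L (Suc (Suc n)) / L (Suc n)"
    using LC_pos[OF assms(1)] by (simp add: field_simps power2_eq_square)
qed

text \<open>The product \<open>L i\<close> of the first \<open>i\<close> quotients is at most the product \<open>L (i + j) / L j\<close> of the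
  \<open>i\<close> quotients starting at position \<open>j\<close>, since the quotients increase.\<close>
lemma LC_superadditive:
  assumes "L \<in> LC"
  shows "L i * L j \<le> L (i + j)"
proof (induction i)
  case 0
  then show ?case using assms by (simp add: LC_def)
next
  case (Suc i)
  note pos = LC_pos[OF assms]
  have "L (Suc i) * L j = L (Suc i) / L i * (L i * L j)"
    using pos[of i] by simp
  also have "\<dots> \<le> L (Suc (i + j)) / L (i + j) * L (i + j)"
    using Suc LC_ratio_mono[OF assms, of i "i + j"] pos
    by (intro mult_mono) (auto intro: less_imp_le)
  also have "\<dots> = L (Suc i + j)"
    using pos[of "i + j"] by simp
  finally show ?case .
qed

text \<open>The slope \<open>ln m\<close> supports the convex function \<open>ln L\<close> at \<open>Suc p\<close>. In other words, the
  supremum of \<open>m ^ j / L j\<close> over \<open>j\<close> is attained at \<open>j = Suc p\<close>.\<close>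
lemma LC_supporting_line:
  fixes p :: nat
  assumes "L \<in> LC"
  defines "m \<equiv> L (Suc p) / L p"
  shows "m ^ j \<le> m ^ Suc p / L (Suc p) * L j"
proof -
  note pos = LC_pos[OF assms(1)]
  have m: "m > 0" using pos by (simp add: m_def)
  have up: "L (Suc p) * m ^ k \<le> L (Suc p + k)" for k
  proof (induction k)
    case (Suc k)
    have "L (Suc p) * m ^ Suc k = m * (L (Suc p) * m ^ k)" by simp
    also have "\<dots> \<le> L (Suc (Suc p + k)) / L (Suc p + k) * L (Suc p + k)"
      unfolding m_def using Suc[unfolded m_def] LC_ratio_mono[OF assms(1), of p "Suc p + k"] pos m
      by (intro mult_mono) (auto intro!: mult_nonneg_nonneg less_imp_le simp: m_def)
    also have "\<dots> = L (Suc p + Suc k)"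
      using pos[of "Suc p + k"] by simp
    finally show ?case .
  qed simp
  have down: "L (q + k) \<le> L q * m ^ k" if "q + k \<le> Suc p" for q k
    using that
  proof (induction k)
    case (Suc k)
    have "L (q + Suc k) = L (Suc (q + k)) / L (q + k) * L (q + k)"
      using pos[of "q + k"] by simp
    also have "\<dots> \<le> m * (L q * m ^ k)"
      unfolding m_def using Suc LC_ratio_mono[OF assms(1), of "q + k" p] pos
      by (intro mult_mono) (auto simp: m_def intro: less_imp_le)
    finally show ?case by (simp add: mult_ac)
  qed simp
  have "L (Suc p) * m ^ j \<le> m ^ Suc p * L j"
  proof (cases "Suc p \<le> j")
    case True
    then have "L (Suc p) * m ^ j = m ^ Suc p * (L (Suc p) * m ^ (j - Suc p))"
      by (metis le_add_diff_inverse mult.left_commute power_add)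
    also have "\<dots> \<le> m ^ Suc p * L (Suc p + (j - Suc p))"
      using m by (intro mult_left_mono up) auto
    finally show ?thesis using True by simp
  next
    case False
    then have "L (j + (Suc p - j)) \<le> L j * m ^ (Suc p - j)" by (intro down) simp
    then have "L (Suc p) * m ^ j \<le> L j * m ^ (Suc p - j) * m ^ j"
      using False m by (intro mult_right_mono) auto
    also have "\<dots> = m ^ Suc p * L j"
      using False by (simp add: power_add[symmetric] mult.assoc del: power_Suc)
    finally show ?thesis .
  qed
  then show ?thesis using pos[of "Suc p"] by (simp add: field_simps)
qed

text \<open>Decreasing terms \<open>r k = L k / L (k + 1)\<close> with sum \<open>s\<close> satisfy \<open>(k + 1) * r k \<le> s\<close>, that is
  \<open>k + 1 \<le> s * L (k + 1) / L k\<close>. Multiply these inequalities.\<close>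
lemma fact_le_non_quasianalytic:
  assumes "L \<in> LC" "non_quasianalytic L"
  shows "\<exists>s>0. \<forall>p. fact p \<le> s ^ p * L p"
proof (intro exI conjI allI)
  define r where "r k = L k / L (Suc k)" for k
  note pos = LC_pos[OF assms(1)]
  have r: "r k > 0" for k using pos by (simp add: r_def)
  have sr: "summable r" using assms(2) by (simp add: r_def[abs_def] non_quasianalytic_def)
  show s: "0 < suminf r" using suminf_pos[OF sr r] .
  fix p
  have step: "real (Suc k) * r k \<le> suminf r" for k
  proof -
    have "r k \<le> r j" if "j \<le> k" for j
      using LC_ratio_mono[OF assms(1) that] pos[of j] pos[of "Suc j"] pos[of k] pos[of "Suc k"]
      by (simp add: r_def field_simps)
    then have "(\<Sum>j\<le>k. r k) \<le> (\<Sum>j\<le>k. r j)" by (intro sum_mono) auto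
    also have "\<dots> \<le> suminf r" using r by (intro sum_le_suminf sr) (auto intro: less_imp_le)
    finally show ?thesis by simp
  qed
  show "fact p \<le> suminf r ^ p * L p"
  proof (induction p)
    case 0
    then show ?case using assms(1) by (simp add: LC_def)
  next
    case (Suc p)
    have "fact (Suc p) = real (Suc p) * fact p" by simp
    also have "\<dots> \<le> real (Suc p) * (suminf r ^ p * L p)"
      using Suc by (intro mult_left_mono) auto
    also have "\<dots> = real (Suc p) * r p * (suminf r ^ p * L (Suc p))"
      using pos[of "Suc p"] by (simp add: r_def)
    also have "\<dots> \<le> suminf r * (suminf r ^ p * L (Suc p))"
      using step s pos[of "Suc p"] by (intro mult_right_mono) (auto intro: less_imp_le)
    finally show ?case by (simp add: mult_ac)
  qed
qed

lemma power_le_fact_exp: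
  fixes x :: real
  assumes "0 \<le> x"
  shows "x ^ n \<le> fact n * exp x"
proof -
  have "(\<Sum>k\<in>{n}. x ^ k /\<^sub>R fact k) \<le> suminf (\<lambda>k. x ^ k /\<^sub>R fact k)"
    using assms by (intro sum_le_suminf sums_summable[OF exp_converges]) auto
  then show ?thesis
    using sums_unique[OF exp_converges[of x]] by (simp add: field_simps)
qed

text \<open>The second factorial in the hypothesis is spent on absorbing an arbitrary geometric factor
  \<open>y ^ p\<close>; the first one remains.\<close>
lemma power_le_weight:
  fixes L :: "nat \<Rightarrow> real"
  assumes fact2: "\<And>p. (fact p)\<^sup>2 \<le> b ^ p * L p" and "0 < b" "0 \<le> y"
  shows "y ^ p * fact p \<le> exp (b * y) * L p"
proof -
  have "b ^ p * (y ^ p * fact p) = (b * y) ^ p * fact p"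
    by (simp add: power_mult_distrib)
  also have "\<dots> \<le> (fact p * exp (b * y)) * fact p"
    using assms by (intro mult_right_mono power_le_fact_exp) auto
  also have "\<dots> = (fact p)\<^sup>2 * exp (b * y)"
    by (simp add: power2_eq_square)
  also have "\<dots> \<le> b ^ p * L p * exp (b * y)"
    by (intro mult_right_mono fact2) auto
  finally have "b ^ p * (y ^ p * fact p) \<le> b ^ p * (exp (b * y) * L p)"
    by (simp add: mult_ac)
  then show ?thesis using \<open>0 < b\<close> by simp
qed

section \<open>Modulated Gaussians\<close>

text \<open>The derivatives of \<open>g x = exp (- x\<^sup>2 / 2)\<close>, by the Hermite recursion that results from
  differentiating \<open>g' x = - x g x\<close> repeatedly.\<close>
fun gauss_deriv :: "nat \<Rightarrow> real \<Rightarrow> real" where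
  "gauss_deriv 0 x = exp (- (x\<^sup>2 / 2))"
| "gauss_deriv (Suc 0) x = - x * gauss_deriv 0 x"
| "gauss_deriv (Suc (Suc k)) x = - x * gauss_deriv (Suc k) x - real (Suc k) * gauss_deriv k x"

lemma gauss_deriv_has_derivative:
  "(gauss_deriv k has_real_derivative gauss_deriv (Suc k) x) (at x)"
proof (induction k x rule: gauss_deriv.induct)
  case (1 x)
  have "((\<lambda>x. exp (- (x\<^sup>2 / 2))) has_real_derivative - x * exp (- (x\<^sup>2 / 2))) (at x)"
    by (auto intro!: derivative_eq_intros simp: power2_eq_square)
  then show ?case by (simp add: gauss_deriv.simps[abs_def])
next
  case (2 x)
  have "((\<lambda>x. - x * gauss_deriv 0 x) has_real_derivative - gauss_deriv 0 x - x * gauss_deriv (Suc 0) x) (at x)"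
    using 2 by (auto intro!: derivative_eq_intros simp del: gauss_deriv.simps)
  moreover have "gauss_deriv (Suc 0) = (\<lambda>x. - x * gauss_deriv 0 x)" by (rule ext) simp
  ultimately show ?case by simp
next
  case (3 k x)
  have "((\<lambda>x. - x * gauss_deriv (Suc k) x - real (Suc k) * gauss_deriv k x) has_real_derivative
      - gauss_deriv (Suc k) x - x * gauss_deriv (Suc (Suc k)) x - real (Suc k) * gauss_deriv (Suc k) x) (at x)"
    using 3 by (auto intro!: derivative_eq_intros simp del: gauss_deriv.simps)
  moreover have "gauss_deriv (Suc (Suc k)) = (\<lambda>x. - x * gauss_deriv (Suc k) x - real (Suc k) * gauss_deriv k x)"
    by (rule ext) simp
  ultimately show ?case by (simp add: algebra_simps)
qed

text \<open>The true size is \<open>sqrt (a! * n!)\<close> up to geometric factors; the crude one with \<open>(a + n)!\<close> is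
  reproduced by the Hermite recursion, as both of its terms are at most half of the new bound.\<close>
lemma gauss_deriv_bound:
  "\<bar>x\<bar> ^ a * \<bar>gauss_deriv n x\<bar> \<le> exp (1/2) * 2 ^ n * fact (a + n)"
proof (induction n x arbitrary: a rule: gauss_deriv.induct)
  case (1 x)
  have "\<bar>x\<bar> ^ a * exp (- (x\<^sup>2 / 2)) \<le> (fact a * exp \<bar>x\<bar>) * exp (- (x\<^sup>2 / 2))"
    by (intro mult_right_mono power_le_fact_exp) auto
  also have "\<dots> = fact a * exp (\<bar>x\<bar> - x\<^sup>2 / 2)" by (simp only: diff_conv_add_uminus exp_add mult.assoc)
  also have "\<dots> \<le> fact a * exp (1/2)"
  proof -
    have "0 \<le> (\<bar>x\<bar> - 1)\<^sup>2" by simp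
    then have "\<bar>x\<bar> - x\<^sup>2 / 2 \<le> 1 / 2" unfolding power2_diff by simp
    then show ?thesis by simp
  qed
  finally show ?case by (simp add: mult_ac)
next
  case (2 x)
  have "\<bar>x\<bar> ^ a * \<bar>gauss_deriv (Suc 0) x\<bar> = \<bar>x\<bar> ^ Suc a * \<bar>gauss_deriv 0 x\<bar>"
    by (simp add: abs_mult)
  also have "\<dots> \<le> exp (1/2) * 2 ^ 0 * fact (Suc a + 0)" by (rule 2)
  also have "\<dots> \<le> exp (1/2) * 2 ^ Suc 0 * fact (a + Suc 0)" by simp
  finally show ?case .
next
  case (3 k x)
  have "\<bar>gauss_deriv (Suc (Suc k)) x\<bar> \<le> \<bar>- x * gauss_deriv (Suc k) x\<bar> + \<bar>real (Suc k) * gauss_deriv k x\<bar>"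
    unfolding gauss_deriv.simps(3) by (rule abs_triangle_ineq4)
  also have "\<dots> = \<bar>x\<bar> * \<bar>gauss_deriv (Suc k) x\<bar> + real (Suc k) * \<bar>gauss_deriv k x\<bar>"
    by (simp only: abs_mult abs_minus_cancel abs_of_nat)
  finally have "\<bar>x\<bar> ^ a * \<bar>gauss_deriv (Suc (Suc k)) x\<bar>
      \<le> \<bar>x\<bar> ^ a * (\<bar>x\<bar> * \<bar>gauss_deriv (Suc k) x\<bar> + real (Suc k) * \<bar>gauss_deriv k x\<bar>)"
    by (intro mult_left_mono) auto
  also have "\<dots> = \<bar>x\<bar> ^ Suc a * \<bar>gauss_deriv (Suc k) x\<bar> + real (Suc k) * (\<bar>x\<bar> ^ a * \<bar>gauss_deriv k x\<bar>)"
    by (simp add: algebra_simps)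
  also have "\<dots> \<le> exp (1/2) * 2 ^ Suc k * fact (Suc a + Suc k) + real (Suc k) * (exp (1/2) * 2 ^ k * fact (a + k))"
    by (intro add_mono mult_left_mono 3) auto
  also have "\<dots> \<le> exp (1/2) * 2 ^ Suc k * fact (Suc a + Suc k) + exp (1/2) * 2 ^ Suc k * fact (Suc a + Suc k)"
  proof (rule add_left_mono)
    have "real (Suc k) * fact (a + k) \<le> fact (Suc (a + k))"
      unfolding fact_Suc by (intro mult_right_mono) auto
    also have "\<dots> \<le> fact (Suc a + Suc k)" by (intro fact_mono) auto
    finally have "exp (1/2) * 2 ^ k * (real (Suc k) * fact (a + k)) \<le> exp (1/2) * 2 ^ Suc k * (fact (Suc a + Suc k))"
      by (intro mult_mono) auto
    then show "real (Suc k) * (exp (1/2) * 2 ^ k * fact (a + k)) \<le> exp (1/2) * 2 ^ Suc k * fact (Suc a + Suc k)"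
      by (simp only: mult_ac)
  qed
  finally have "\<bar>x\<bar> ^ a * \<bar>gauss_deriv (Suc (Suc k)) x\<bar>
      \<le> exp (1/2) * 2 ^ Suc k * fact (Suc a + Suc k) + exp (1/2) * 2 ^ Suc k * fact (Suc a + Suc k)" .
  moreover have "a + Suc (Suc k) = Suc a + Suc k" by simp
  ultimately show ?case
    by (simp only: power_Suc[of 2 "Suc k"] mult_2 mult.left_commute mult.assoc distrib_left distrib_right)
qed

text \<open>\<open>(\<i> t + D) ^ n (D ^ j g)\<close>, where \<open>D\<close> is differentiation. Multiplication by \<open>exp (\<i> t x)\<close> turns \<open>\<i> t + D\<close>
  into \<open>D\<close>, so the case \<open>j = 0\<close> gives the derivatives of the modulated Gaussian. The index \<open>j\<close>
  makes estimates by induction on \<open>n\<close> possible without expanding the binomial.\<close>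
primrec modulated :: "real \<Rightarrow> nat \<Rightarrow> nat \<Rightarrow> real \<Rightarrow> complex" where
  "modulated t 0 j x = of_real (gauss_deriv j x)"
| "modulated t (Suc n) j x = \<i> * of_real t * modulated t n j x + modulated t n (Suc j) x"

text \<open>The \<open>n\<close>-th derivative of \<open>exp (\<i> t x - x\<^sup>2 / 2)\<close>.\<close>
definition wave_packet :: "real \<Rightarrow> nat \<Rightarrow> real \<Rightarrow> complex" where
  "wave_packet t n x = exp (\<i> * of_real t * of_real x) * modulated t n 0 x"

lemma modulated_has_derivative:
  "(modulated t n j has_vector_derivative modulated t n (Suc j) x) (at x)"
proof (induction n arbitrary: j)
  case 0
  have "((\<lambda>x. complex_of_real (gauss_deriv j x)) has_vector_derivative of_real (gauss_deriv (Suc j) x)) (at x)"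
    using gauss_deriv_has_derivative[of j x]
    by (intro has_vector_derivative_of_real) (simp add: has_real_derivative_iff_has_vector_derivative)
  then show ?case by simp
next
  case (Suc n)
  have "((\<lambda>x. \<i> * of_real t * modulated t n j x + modulated t n (Suc j) x) has_vector_derivative
      \<i> * of_real t * modulated t n (Suc j) x + modulated t n (Suc (Suc j)) x) (at x)"
    by (intro has_vector_derivative_add has_vector_derivative_mult_right Suc)
  moreover have "modulated t (Suc n) j = (\<lambda>x. \<i> * of_real t * modulated t n j x + modulated t n (Suc j) x)"
    by (rule ext) simp
  ultimately show ?case by simp
qed

lemma wave_packet_has_derivative:
  "(wave_packet t n has_vector_derivative wave_packet t (Suc n) x) (at x)"
proof -
  have "((\<lambda>z. exp (\<i> * of_real t * z)) has_field_derivative \<i> * of_real t * exp (\<i> * of_real t * of_real x))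
      (at (complex_of_real x))"
    by (auto intro!: derivative_eq_intros)
  then have "((\<lambda>x. exp (\<i> * of_real t * complex_of_real x)) has_vector_derivative
      \<i> * of_real t * exp (\<i> * of_real t * of_real x)) (at x)"
    by (rule has_vector_derivative_real_field)
  from has_vector_derivative_mult[OF this modulated_has_derivative[of t n 0 x]]
  show ?thesis
    by (simp add: wave_packet_def[abs_def] algebra_simps)
qed

lemma norm_wave_packet: "norm (wave_packet t n x) = norm (modulated t n 0 x)"
  by (simp add: wave_packet_def norm_mult)

text \<open>At \<open>0\<close> the Hermite recursion reads \<open>g (k + 2) = - (k + 1) * g k\<close>, where \<open>-1 = \<i>\<^sup>2\<close>. So \<open>D ^ j g\<close> has phase
  \<open>\<i> ^ j\<close> there, and hence the two terms added in each application of \<open>\<i> t + D\<close> have the same phase and cannot cancel for \<open>t \<ge> 0\<close>.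
  Dropping the second term in each step leaves \<open>t ^ n\<close>.\<close>
lemma wave_packet_at_0_ge:
  assumes "0 \<le> t"
  shows "t ^ n \<le> norm (wave_packet t n 0)"
proof -
  have gauss: "\<exists>c\<ge>0. complex_of_real (gauss_deriv j 0) = \<i> ^ j * of_real c" for j
  proof (induction j "0::real" rule: gauss_deriv.induct)
    case 1
    show ?case by (intro exI[of _ 1]) simp
  next
    case 2
    show ?case by (intro exI[of _ 0]) simp
  next
    case (3 k)
    obtain c where c: "c \<ge> 0" "complex_of_real (gauss_deriv k 0) = \<i> ^ k * of_real c"
      using 3 by blast
    show ?case
      by (intro exI[of _ "real (Suc k) * c"]) (use c in simp)
  qed
  have "\<exists>c\<ge>0. modulated t n j 0 = \<i> ^ (n + j) * of_real c" for n j
  proof (induction n arbitrary: j)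
    case 0
    then show ?case using gauss by simp
  next
    case (Suc n)
    obtain c d where "c \<ge> 0" "modulated t n j 0 = \<i> ^ (n + j) * of_real c"
      "d \<ge> 0" "modulated t n (Suc j) 0 = \<i> ^ (n + Suc j) * of_real d"
      using Suc by meson
    then show ?case using assms
      by (intro exI[of _ "t * c + d"]) (simp add: algebra_simps)
  qed
  note phase = this
  have "\<exists>c\<ge>t ^ n. modulated t n 0 0 = \<i> ^ n * of_real c"
  proof (induction n)
    case 0
    show ?case by (intro exI[of _ 1]) simp
  next
    case (Suc n)
    then obtain c where c: "c \<ge> t ^ n" "modulated t n 0 0 = \<i> ^ n * of_real c" by blast
    obtain d where d: "d \<ge> 0" "modulated t n (Suc 0) 0 = \<i> ^ (n + Suc 0) * of_real d"
      using phase by blast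
    have "t * t ^ n \<le> t * c + d" using c d assms by (simp add: add_increasing2 mult_left_mono)
    then show ?case
      by (intro exI[of _ "t * c + d"]) (use c d in \<open>simp add: algebra_simps\<close>)
  qed
  then obtain c where "c \<ge> t ^ n" "modulated t n 0 0 = \<i> ^ n * of_real c" by blast
  then show ?thesis
    by (simp add: norm_wave_packet norm_mult norm_power)
qed

text \<open>The factor \<open>t ^ i\<close> on the left collects the powers of \<open>t\<close> that the induction on \<open>n\<close> produces.
  They are converted into weights only at \<open>n = 0\<close>, where \<open>freq\<close> trades \<open>t ^ i\<close> for \<open>L i\<close> and \<open>shift\<close> absorbs
  \<open>L i\<close> into \<open>w\<close>. Apart from \<open>2 ^ n\<close> and \<open>a\<close>, the bound depends on \<open>i + j + n\<close> only, so each step merely doubles it.\<close>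
lemma modulated_bound:
  fixes L :: "nat \<Rightarrow> real" and w :: "nat \<Rightarrow> nat \<Rightarrow> real"
  assumes shift: "\<And>i a j. L i * w a j \<le> w a (i + j)"
    and gauss: "\<And>a j. \<bar>x\<bar> ^ a * \<bar>gauss_deriv j x\<bar> \<le> K * (r ^ (a + j) * w a j)"
    and freq: "\<And>j. t ^ j \<le> T * (r ^ j * L j)"
    and "0 \<le> t" "0 \<le> r" "0 \<le> K" "0 \<le> T"
  shows "t ^ i * (\<bar>x\<bar> ^ a * norm (modulated t n j x))
    \<le> 2 ^ n * (T * K * (r ^ (a + (i + j + n)) * w a (i + j + n)))"
proof (induction n arbitrary: i j)
  case 0
  have "t ^ i * (\<bar>x\<bar> ^ a * \<bar>gauss_deriv j x\<bar>) \<le> (T * (r ^ i * L i)) * (K * (r ^ (a + j) * w a j))"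
    using order_trans[OF zero_le_power[OF \<open>0 \<le> t\<close>] freq[of i]]
    by (intro mult_mono gauss freq) auto
  also have "\<dots> = T * K * r ^ (a + (i + j)) * (L i * w a j)"
    by (simp add: power_add mult_ac)
  also have "\<dots> \<le> T * K * r ^ (a + (i + j)) * w a (i + j)"
    using assms by (intro mult_left_mono shift) auto
  finally show ?case by (simp add: mult_ac)
next
  case (Suc n)
  let ?R = "2 ^ n * (T * K * (r ^ (a + (i + j + Suc n)) * w a (i + j + Suc n)))"
  have "t ^ i * (\<bar>x\<bar> ^ a * norm (modulated t (Suc n) j x))
      \<le> t ^ i * (\<bar>x\<bar> ^ a * (t * norm (modulated t n j x) + norm (modulated t n (Suc j) x)))"
    using \<open>0 \<le> t\<close>
    by (intro mult_left_mono) (auto intro!: order_trans[OF norm_triangle_ineq] simp: norm_mult)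
  also have "\<dots> = t ^ Suc i * (\<bar>x\<bar> ^ a * norm (modulated t n j x))
      + t ^ i * (\<bar>x\<bar> ^ a * norm (modulated t n (Suc j) x))"
    by (simp add: algebra_simps)
  also have "\<dots> \<le> ?R + ?R"
    using Suc[of "Suc i" j] Suc[of i "Suc j"] by (intro add_mono) simp_all
  also have "\<dots> = 2 ^ Suc n * (T * K * (r ^ (a + (i + j + Suc n)) * w a (i + j + Suc n)))" by simp
  finally show ?case .
qed

lemma wave_packet_bound:
  fixes L :: "nat \<Rightarrow> real" and w :: "nat \<Rightarrow> nat \<Rightarrow> real"
  assumes shift: "\<And>i a j. L i * w a j \<le> w a (i + j)"
    and gauss: "\<And>a j x. \<bar>x\<bar> ^ a * \<bar>gauss_deriv j x\<bar> \<le> K * ((h / 2) ^ (a + j) * w a j)"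
    and freq: "\<And>j. t ^ j \<le> T * ((h / 2) ^ j * L j)"
    and "0 \<le> t" "0 \<le> h" "0 \<le> K" "0 \<le> T" "\<And>a j. 0 \<le> w a j"
  shows "\<bar>x\<bar> ^ a * norm (wave_packet t n x) \<le> T * K * (h ^ (a + n) * w a n)"
proof -
  have "\<bar>x\<bar> ^ a * norm (wave_packet t n x) \<le> 2 ^ n * (T * K * ((h / 2) ^ (a + n) * w a n))"
    using modulated_bound[of L w x K "h / 2" t T 0 a n 0, OF shift gauss freq] assms(4-7)
    by (simp add: norm_wave_packet)
  also have "\<dots> \<le> 2 ^ (a + n) * (T * K * ((h / 2) ^ (a + n) * w a n))"
    using assms by (intro mult_right_mono power_increasing mult_nonneg_nonneg) auto
  also have "\<dots> = T * K * (h ^ (a + n) * w a n)"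
    by (simp add: power_divide)
  finally show ?thesis .
qed

text \<open>Combine \<open>(a + j)! \<le> 2 ^ (a + j) * a! * j!\<close> with \<open>power_le_weight\<close> for \<open>y = 4 / r\<close>: one factor \<open>2\<close> comes
  from the binomial coefficient, the other from the Gaussian bound.\<close>
lemma gauss_deriv_weight_bound:
  fixes L :: "nat \<Rightarrow> real" and w :: "nat \<Rightarrow> nat \<Rightarrow> real"
  assumes fact2: "\<And>p. (fact p)\<^sup>2 \<le> b ^ p * L p" and "0 < b" "0 < r"
    and w: "\<And>a j. L a * L j \<le> w a j" and L: "\<And>p. 0 \<le> L p"
  shows "\<exists>K>0. \<forall>a j x. \<bar>x\<bar> ^ a * \<bar>gauss_deriv j x\<bar> \<le> K * (r ^ (a + j) * w a j)"
proof (intro exI conjI allI)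
  define E where "E = exp (b * (4 / r))"
  show "0 < exp (1/2) * E * E" by (simp add: E_def)
  fix a j :: nat and x :: real
  have fact: "fact p * 4 ^ p \<le> E * (r ^ p * L p)" for p
  proof -
    have "(4 / r) ^ p * fact p \<le> E * L p"
      using power_le_weight[OF fact2, of "4 / r" p] assms(2,3) by (simp add: E_def)
    then have "r ^ p * ((4 / r) ^ p * fact p) \<le> r ^ p * (E * L p)"
      using \<open>0 < r\<close> by (intro mult_left_mono) auto
    then show ?thesis using \<open>0 < r\<close> by (simp add: power_divide mult_ac)
  qed
  have "fact (a + j) = fact a * fact j * real ((a + j) choose a)"
    using binomial_fact_lemma[of a "a + j"]
    by (metis add_diff_cancel_left' le_add1 of_nat_fact of_nat_mult)
  also have "\<dots> \<le> fact a * fact j * 2 ^ (a + j)"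
    using binomial_le_pow2[of "a + j" a] by (intro mult_left_mono) (simp_all flip: of_nat_le_iff)
  finally have *: "fact (a + j) \<le> fact a * fact j * (2::real) ^ (a + j)" .
  have "\<bar>x\<bar> ^ a * \<bar>gauss_deriv j x\<bar> \<le> exp (1/2) * 2 ^ j * fact (a + j)"
    by (rule gauss_deriv_bound)
  also have "\<dots> \<le> exp (1/2) * 2 ^ (a + j) * (fact a * fact j * 2 ^ (a + j))"
    by (intro mult_mono * power_increasing) auto
  also have "\<dots> = exp (1/2) * ((fact a * 4 ^ a) * (fact j * 4 ^ j))"
  proof -
    have "(4::real) ^ n = 2 ^ n * 2 ^ n" for n by (simp flip: power_mult_distrib)
    then show ?thesis by (simp add: power_add mult_ac)
  qed
  also have "\<dots> \<le> exp (1/2) * ((E * (r ^ a * L a)) * (E * (r ^ j * L j)))"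
    using \<open>0 < r\<close> L by (intro mult_left_mono mult_mono fact) (auto simp: E_def)
  also have "\<dots> = exp (1/2) * E * E * r ^ (a + j) * (L a * L j)"
    by (simp add: power_add mult_ac)
  also have "\<dots> \<le> exp (1/2) * E * E * r ^ (a + j) * w a j"
    using \<open>0 < r\<close> by (intro mult_left_mono w) (auto simp: E_def)
  finally show "\<bar>x\<bar> ^ a * \<bar>gauss_deriv j x\<bar> \<le> exp (1/2) * E * E * (r ^ (a + j) * w a j)"
    by (simp add: mult_ac)
qed

section \<open>Functions of one variable\<close>

context
  fixes i0 :: "'d::finite"
  assumes UNIV1: "(UNIV :: 'd set) = {i0}"
begin

lemma vec_one_dim: "(\<alpha> :: 'a ^ 'd) = vec (\<alpha> $ i0)"
  unfolding vec_eq_iff using UNIV1 by (metis UNIV_I singletonD vec_component)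

lemma mi_abs_one_dim: "mi_abs (\<alpha> :: nat ^ 'd) = \<alpha> $ i0"
  by (simp add: mi_abs_def UNIV1)

lemma monomial_one_dim: "monomial (\<alpha> :: nat ^ 'd) x = (x $ i0) ^ (\<alpha> $ i0)"
  by (simp add: monomial_def UNIV1)

context
  fixes F :: "nat \<Rightarrow> real \<Rightarrow> complex"
  assumes deriv: "\<And>n x. (F n has_vector_derivative F (Suc n) x) (at x)"
begin

lemma has_vector_derivative_lift_one_dim:
  "((\<lambda>t. F n ((x + t *\<^sub>R axis i 1 :: real ^ 'd) $ i0)) has_vector_derivative F (Suc n) (x $ i0)) (at 0)"
proof -
  have i: "i = i0" using UNIV1 by auto
  have "((\<lambda>t. x $ i0 + t) has_vector_derivative 1) (at 0)"
    by (auto intro!: derivative_eq_intros)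
  from vector_diff_chain_at[OF this, of "F n" "F (Suc n) (x $ i0)"] deriv[of n "x $ i0"]
  show ?thesis by (simp add: i o_def)
qed

lemma partial_lift_one_dim:
  "partial i (\<lambda>x :: real ^ 'd. F n (x $ i0)) = (\<lambda>x. F (Suc n) (x $ i0))"
  unfolding partial_def by (rule ext) (rule vector_derivative_at[OF has_vector_derivative_lift_one_dim])

lemma smooth_lift_one_dim: "smooth (\<lambda>x :: real ^ 'd. F n (x $ i0))"
proof -
  have cont: "continuous_on UNIV (F n)" for n
    using has_vector_derivative_continuous[OF deriv] by (simp add: continuous_on_eq_continuous_at)
  have "continuous_on UNIV (\<lambda>x :: real ^ 'd. F n (x $ i0))" for n
    by (rule continuous_on_compose2[OF cont]) (auto intro: continuous_intros)
  moreover have "has_partial i (\<lambda>x :: real ^ 'd. F n (x $ i0)) x" for i n x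
    unfolding has_partial_def by (rule differentiableI_vector[OF has_vector_derivative_lift_one_dim])
  ultimately have "C_k k (\<lambda>x :: real ^ 'd. F n (x $ i0))" for k n
    by (induction k arbitrary: n) (simp_all add: partial_lift_one_dim)
  then show ?thesis by (simp add: smooth_def)
qed

text \<open>With a single coordinate, the list chosen in \<^const>\<open>multi_partial\<close> is determined by its length.\<close>
lemma multi_partial_lift_one_dim:
  "multi_partial \<beta> (\<lambda>x :: real ^ 'd. F 0 (x $ i0)) = (\<lambda>x. F (\<beta> $ i0) (x $ i0))"
proof -
  define js where "js = (SOME is. \<forall>i. count_list is i = \<beta> $ i)"
  have "\<forall>i. count_list js i = \<beta> $ i"
    unfolding js_def by (rule someI_ex[OF ex_count_list_multi_index])
  moreover have "count_list is i0 = length is" for "is"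
    using UNIV1 by (induction "is") auto
  ultimately have len: "length js = \<beta> $ i0" by metis
  have "foldr partial is (\<lambda>x :: real ^ 'd. F 0 (x $ i0)) = (\<lambda>x. F (length is) (x $ i0))" for "is"
    by (induction "is") (simp_all add: partial_lift_one_dim)
  then show ?thesis by (simp add: multi_partial_def len flip: js_def)
qed

end

end

section \<open>Joint and separated growth\<close>

lemma growth_increasing_weights:
  assumes "weight_matrix M" "growth \<in> {joint_growth, separated_growth}"
  shows "increasing_weights (growth M)"
proof -
  have pos: "0 < M \<mu> \<alpha>" if "0 < \<mu>" for \<mu> \<alpha>
    using assms(1) that by (simp add: weight_matrix_def)
  have mono: "M \<mu> \<alpha> \<le> M \<kappa> \<alpha>" if "0 < \<mu>" "\<mu> \<le> \<kappa>" for \<mu> \<kappa> \<alpha>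
    using assms(1) that by (simp add: weight_matrix_def)
  have "M \<mu> \<alpha> * M \<mu> \<beta> \<le> M \<kappa> \<alpha> * M \<kappa> \<beta>" if "0 < \<mu>" "\<mu> \<le> \<kappa>" for \<mu> \<kappa> \<alpha> \<beta>
    using that pos[of \<mu>] pos[of \<kappa>] by (intro mult_mono mono) (auto intro: less_imp_le)
  then show ?thesis
    using assms(2) pos mono
    by (auto simp: increasing_weights_def joint_growth_def separated_growth_def)
qed

lemma mi_abs_add: "mi_abs (\<alpha> + \<beta>) = mi_abs \<alpha> + mi_abs \<beta>"
  by (simp add: mi_abs_def sum.distrib)

lemma beurling_preceq_imp_continuously_included:
  assumes M: "weight_matrix M" and N: "weight_matrix N" and "beurling_preceq M N"
    and growth: "growth \<in> {joint_growth, separated_growth}"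
  shows "continuously_included (growth M) (growth N)"
proof (rule continuously_included_if_dominated)
  fix \<mu> h :: real assume \<mu>: "0 < \<mu>" and h: "0 < h"
  obtain \<kappa> C where \<kappa>: "\<kappa> > 0" and C: "C \<ge> 1" "\<And>\<alpha>. M \<kappa> \<alpha> \<le> C ^ mi_abs \<alpha> * N \<mu> \<alpha>"
    using assms(3) \<mu> unfolding beurling_preceq_def seq_preceq_def by blast
  have pos: "0 < M \<kappa> \<alpha>" "0 < N \<mu> \<alpha>" for \<alpha>
    using M N \<mu> \<kappa> by (auto simp: weight_matrix_def)
  have "growth M \<kappa> \<alpha> \<beta> \<le> C ^ mi_abs (\<alpha> + \<beta>) * growth N \<mu> \<alpha> \<beta>" for \<alpha> \<beta>
  proof -
    have "M \<kappa> \<alpha> * M \<kappa> \<beta> \<le> (C ^ mi_abs \<alpha> * N \<mu> \<alpha>) * (C ^ mi_abs \<beta> * N \<mu> \<beta>)"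
      using C pos by (intro mult_mono C mult_nonneg_nonneg) (auto intro: less_imp_le)
    then show ?thesis
      using growth C(2)[of "\<alpha> + \<beta>"]
      by (auto simp: joint_growth_def separated_growth_def mi_abs_add power_add mult_ac)
  qed
  then have "(h / C) ^ mi_abs (\<alpha> + \<beta>) * growth M \<kappa> \<alpha> \<beta> \<le> h ^ mi_abs (\<alpha> + \<beta>) * growth N \<mu> \<alpha> \<beta>" for \<alpha> \<beta>
    using h C(1) by (simp add: power_divide field_simps)
  then have "S_seminorm (growth N \<mu>) h f \<le> S_seminorm (growth M \<kappa>) (h / C) f" for f
    by (rule S_seminorm_weight_mono)
  then show "\<exists>\<kappa>>0. \<exists>k>0. \<forall>f. S_seminorm (growth N \<mu>) h f \<le> S_seminorm (growth M \<kappa>) k f"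
    using \<kappa> h C(1) by (intro exI[of _ \<kappa>] exI[of _ "h / C"] conjI allI) simp_all
qed

lemma vec_add_nat: "vec a + vec b = (vec (a + b) :: nat ^ 'd)"
  by (simp add: vec_eq_iff)

text \<open>All that the test functions need to know about the growth: these two inequalities hold for
  joint and for separated growth, which allows one argument for both.\<close>
lemma growth_superadditive:
  assumes "as_sequences M \<kappa> \<in> LC" "growth \<in> {joint_growth, separated_growth}"
  shows "as_sequences M \<kappa> a * as_sequences M \<kappa> j \<le> growth M \<kappa> (vec a) (vec j)"
    and "as_sequences M \<kappa> i * growth M \<kappa> (vec a) (vec j) \<le> growth M \<kappa> (vec a) (vec (i + j))"
proof -
  note sup = LC_superadditive[OF assms(1)]
  show "as_sequences M \<kappa> a * as_sequences M \<kappa> j \<le> growth M \<kappa> (vec a) (vec j)"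
    using assms(2) sup[of a j]
    by (auto simp: joint_growth_def separated_growth_def as_sequences_def vec_add_nat)
  have "as_sequences M \<kappa> a * (as_sequences M \<kappa> i * as_sequences M \<kappa> j)
      \<le> as_sequences M \<kappa> a * as_sequences M \<kappa> (i + j)"
    using LC_pos[OF assms(1), of a] by (intro mult_left_mono sup) simp
  then show "as_sequences M \<kappa> i * growth M \<kappa> (vec a) (vec j) \<le> growth M \<kappa> (vec a) (vec (i + j))"
    using assms(2) sup[of i "a + j"]
    by (auto simp: joint_growth_def separated_growth_def as_sequences_def vec_add_nat ac_simps)
qed

section \<open>Recovering the relation between the weights\<close>

lemma fact_squared_le_weight:
  assumes "standard_log_convex L" "beurling_non_quasianalytic L" "0 < \<mu>"
    and sq: "\<forall>\<mu>>0. \<exists>\<kappa>>0. \<exists>A\<ge>1. \<forall>p. (L \<kappa> p)\<^sup>2 \<le> A ^ p * L \<mu> p"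
  shows "\<exists>b>0. \<forall>p. (fact p)\<^sup>2 \<le> b ^ p * L \<mu> p"
proof -
  obtain \<kappa> A where \<kappa>: "\<kappa> > 0" and A: "A \<ge> 1" "\<And>p. (L \<kappa> p)\<^sup>2 \<le> A ^ p * L \<mu> p"
    using sq assms(3) by blast
  obtain s where s: "s > 0" "\<And>p. fact p \<le> s ^ p * L \<kappa> p"
    using fact_le_non_quasianalytic assms(1,2) \<kappa>
    unfolding standard_log_convex_def beurling_non_quasianalytic_def by blast
  have "(fact p)\<^sup>2 \<le> (s\<^sup>2 * A) ^ p * L \<mu> p" for p
  proof -
    have "(fact p)\<^sup>2 \<le> (s ^ p * L \<kappa> p)\<^sup>2"
      by (intro power_mono s) auto
    also have "\<dots> = (s\<^sup>2) ^ p * (L \<kappa> p)\<^sup>2"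
      by (simp add: power_mult_distrib mult.commute flip: power_mult)
    also have "\<dots> \<le> (s\<^sup>2) ^ p * (A ^ p * L \<mu> p)"
      by (intro mult_left_mono A) auto
    finally show ?thesis by (simp add: power_mult_distrib mult_ac)
  qed
  then show ?thesis using s A by (intro exI[of _ "s\<^sup>2 * A"]) auto
qed

lemma wave_packet_S_seminorm_le:
  fixes M :: "real \<Rightarrow> nat ^ 'd \<Rightarrow> real" and i0 :: 'd
  assumes UNIV1: "UNIV = {i0}" and M: "weight_matrix M" and LC: "as_sequences M \<kappa> \<in> LC"
    and growth: "growth \<in> {joint_growth, separated_growth}" and pos: "0 < \<kappa>" "0 < h" "0 \<le> t" "0 \<le> c" "0 \<le> K" "0 \<le> T"
    and gauss: "\<And>a j x. \<bar>x\<bar> ^ a * \<bar>gauss_deriv j x\<bar> \<le> K * ((h / 2) ^ (a + j) * growth M \<kappa> (vec a) (vec j))"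
    and freq: "\<And>j. t ^ j \<le> T * ((h / 2) ^ j * as_sequences M \<kappa> j)"
  shows "S_seminorm (growth M \<kappa>) h (\<lambda>x. of_real c * wave_packet t 0 (x $ i0)) \<le> ennreal (c * (T * K))"
proof -
  have w: "0 < growth M \<kappa> \<alpha> \<beta>" for \<alpha> \<beta>
    using growth_increasing_weights[OF M growth] pos by (simp add: increasing_weights_def)
  have "((\<lambda>x. of_real c * wave_packet t n x) has_vector_derivative of_real c * wave_packet t (Suc n) x) (at x)" for n x
    by (intro has_vector_derivative_mult_right wave_packet_has_derivative)
  note mp = multi_partial_lift_one_dim[OF UNIV1, of "\<lambda>n x. of_real c * wave_packet t n x", OF this]
  have "\<bar>x\<bar> ^ a * norm (wave_packet t n x) \<le> T * K * (h ^ (a + n) * growth M \<kappa> (vec a) (vec n))" for x a n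
    using pos w growth_superadditive(2)[OF LC growth] gauss freq
    by (intro wave_packet_bound[where L = "as_sequences M \<kappa>" and w = "\<lambda>a n. growth M \<kappa> (vec a) (vec n)"])
       (auto intro: less_imp_le)
  then have bound: "c * (\<bar>x\<bar> ^ a * norm (wave_packet t n x)) \<le> c * (T * K * (h ^ (a + n) * growth M \<kappa> (vec a) (vec n)))"
    for x a n
    using pos by (intro mult_left_mono)
  show ?thesis
  proof (subst S_seminorm_le_iff, use pos w in simp_all, intro allI)
    fix \<alpha> \<beta> :: "nat ^ 'd" and x :: "real ^ 'd"
    have "growth M \<kappa> \<alpha> \<beta> = growth M \<kappa> (vec (\<alpha> $ i0)) (vec (\<beta> $ i0))"
      using vec_one_dim[OF UNIV1, of \<alpha>] vec_one_dim[OF UNIV1, of \<beta>] by metis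
    then show "\<bar>monomial \<alpha> x\<bar> * cmod (multi_partial \<beta> (\<lambda>x. complex_of_real c * wave_packet t 0 (x $ i0)) x)
       \<le> c * (T * K) * (h ^ mi_abs (\<alpha> + \<beta>) * growth M \<kappa> \<alpha> \<beta>)"
      using bound[of "x $ i0" "\<alpha> $ i0" "\<beta> $ i0"] pos
      by (simp add: mp mi_abs_one_dim[OF UNIV1] monomial_one_dim[OF UNIV1] norm_mult power_abs mult_ac)
  qed
qed

text \<open>For each \<open>p\<close> a test function is adapted to the index \<open>Suc p\<close>: its frequency \<open>t\<close> is the quotient \<open>m\<close> of
  the weights, rescaled by \<open>h / 2\<close>, and its amplitude \<open>c\<close> puts it into the ball of radius \<open>\<delta>\<close>. The
  factor \<open>K\<close> depends on \<open>\<kappa>\<close> and \<open>h\<close> but not on \<open>p\<close>.\<close>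
lemma continuously_included_imp_beurling_preceq:
  fixes M N :: "real \<Rightarrow> nat ^ 'd::finite \<Rightarrow> real"
  assumes M: "weight_matrix M" and N: "weight_matrix N"
    and growth: "growth \<in> {joint_growth, separated_growth}"
    and dim: "CARD('d) = 1"
    and slc: "standard_log_convex (as_sequences M)"
    and nqa: "beurling_non_quasianalytic (as_sequences M)"
    and sq: "\<forall>\<mu>>0. \<exists>\<kappa>>0. \<exists>A\<ge>1. \<forall>p. (as_sequences M \<kappa> p)\<^sup>2 \<le> A ^ p * as_sequences M \<mu> p"
    and incl: "continuously_included (growth M) (growth N)"
  shows "beurling_preceq M N"
  unfolding beurling_preceq_def
proof (intro allI impI)
  fix \<mu> :: real assume \<mu>: "0 < \<mu>"
  obtain i0 :: 'd where UNIV1: "UNIV = {i0}"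
    using dim card_1_singletonE by blast
  have LC: "as_sequences M \<kappa> \<in> LC" if "0 < \<kappa>" for \<kappa>
    using slc that by (simp add: standard_log_convex_def)
  have gauss: "\<exists>K>0. \<forall>a j x. \<bar>x\<bar> ^ a * \<bar>gauss_deriv j x\<bar>
      \<le> K * (r ^ (a + j) * growth M \<kappa> (vec a) (vec j))" if \<kappa>: "0 < \<kappa>" and r: "0 < r" for \<kappa> r
  proof -
    obtain b where b: "b > 0" "\<And>p. (fact p)\<^sup>2 \<le> b ^ p * as_sequences M \<kappa> p"
      using fact_squared_le_weight[OF slc nqa \<kappa> sq] by blast
    show ?thesis
      by (rule gauss_deriv_weight_bound[OF b(2,1) r growth_superadditive(1)[OF LC[OF \<kappa>] growth]])
         (simp add: LC_pos[OF LC[OF \<kappa>]] less_imp_le)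
  qed
  have mem: "(\<lambda>x. of_real c * wave_packet t 0 (x $ i0)) \<in> S_space (growth M)"
    if c: "0 \<le> c" and t: "0 \<le> t" for c t
  proof -
    have "S_seminorm (growth M \<kappa>) h (\<lambda>x. of_real c * wave_packet t 0 (x $ i0)) < \<infinity>"
      if \<kappa>: "0 < \<kappa>" and h: "0 < h" for \<kappa> h
    proof -
      obtain K where K: "K > 0" "\<And>a j x. \<bar>x\<bar> ^ a * \<bar>gauss_deriv j x\<bar>
          \<le> K * ((h / 2) ^ (a + j) * growth M \<kappa> (vec a) (vec j))"
        using gauss[of \<kappa> "h / 2"] \<kappa> h by auto
      obtain b where b: "b > 0" "\<And>p. (fact p)\<^sup>2 \<le> b ^ p * as_sequences M \<kappa> p"
        using fact_squared_le_weight[OF slc nqa \<kappa> sq] by blast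
      \<comment> \<open>Membership only requires some finite \<open>T\<close>; the factorial bound supplies one for any \<open>t\<close>.\<close>
      define T where "T = exp (b * (t / (h / 2)))"
      have freq: "t ^ j \<le> T * ((h / 2) ^ j * as_sequences M \<kappa> j)" for j
      proof -
        have "(t / (h / 2)) ^ j * 1 \<le> (t / (h / 2)) ^ j * fact j"
          using t h by (intro mult_left_mono fact_ge_1) auto
        also have "\<dots> \<le> T * as_sequences M \<kappa> j"
          unfolding T_def using t h by (intro power_le_weight[OF b(2,1)]) auto
        finally have "(h / 2) ^ j * (t / (h / 2)) ^ j \<le> (h / 2) ^ j * (T * as_sequences M \<kappa> j)"
          using h by (intro mult_left_mono) auto
        then show ?thesis using h by (simp add: mult_ac flip: power_mult_distrib)
      qed
      have "S_seminorm (growth M \<kappa>) h (\<lambda>x. of_real c * wave_packet t 0 (x $ i0)) \<le> ennreal (c * (T * K))"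
        using K c t \<kappa> h freq by (intro wave_packet_S_seminorm_le[OF UNIV1 M LC growth]) (auto simp: T_def)
      then show ?thesis by (rule le_less_trans) simp
    qed
    moreover have "smooth (\<lambda>x :: real ^ 'd. of_real c * wave_packet t 0 (x $ i0))"
      by (rule smooth_lift_one_dim[OF UNIV1, of "\<lambda>n x. of_real c * wave_packet t n x"])
         (intro has_vector_derivative_mult_right wave_packet_has_derivative)
    ultimately show ?thesis by (simp add: S_space_def)
  qed
  obtain \<kappa> h \<delta> where pos: "\<kappa> > 0" "h > 0" "\<delta> > 0" and
    ball: "\<And>f. f \<in> S_space (growth M) \<Longrightarrow> S_seminorm (growth M \<kappa>) h f < ennreal \<delta> \<Longrightarrow>
      S_seminorm (growth N \<mu>) 1 f < 1"
    using continuously_included_unit_ball[OF growth_increasing_weights[OF M growth] incl \<mu>] by blast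
  obtain K where K: "K > 0" "\<And>a j x. \<bar>x\<bar> ^ a * \<bar>gauss_deriv j x\<bar>
      \<le> K * ((h / 2) ^ (a + j) * growth M \<kappa> (vec a) (vec j))"
    using gauss[of \<kappa> "h / 2"] pos by auto
  let ?L = "as_sequences M \<kappa>"
  note Lpos = LC_pos[OF LC[OF pos(1)]]
  have N0: "growth N \<mu> 0 \<beta> = N \<mu> \<beta>" for \<beta>
    using growth N \<mu> by (auto simp: joint_growth_def separated_growth_def weight_matrix_def)
  have Npos: "0 < N \<mu> \<alpha>" for \<alpha> using N \<mu> by (simp add: weight_matrix_def)
  have main: "?L (Suc p) \<le> (2 * K / \<delta>) * (2 / h) ^ Suc p * N \<mu> (vec (Suc p))" for p
  proof -
    define m where "m = ?L (Suc p) / ?L p"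
    define T where "T = m ^ Suc p / ?L (Suc p)"
    define t where "t = h / 2 * m"
    define c where "c = \<delta> / (2 * (T * K))"
    have m: "m > 0" using Lpos by (simp add: m_def)
    have T: "T > 0" using Lpos m by (simp add: T_def)
    have t: "t > 0" using pos m by (simp add: t_def)
    have c: "c > 0" using pos T K by (simp add: c_def)
    have freq: "t ^ j \<le> T * ((h / 2) ^ j * ?L j)" for j
    proof -
      have "(h / 2) ^ j * m ^ j \<le> (h / 2) ^ j * (T * ?L j)"
        using LC_supporting_line[OF LC[OF pos(1)], of p j] pos
        by (intro mult_left_mono) (auto simp: m_def T_def)
      then show ?thesis by (simp only: t_def power_mult_distrib mult_ac)
    qed
    let ?f = "\<lambda>x :: real ^ 'd. complex_of_real c * wave_packet t 0 (x $ i0)"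
    have "S_seminorm (growth M \<kappa>) h ?f \<le> ennreal (c * (T * K))"
      using pos K c t T freq by (intro wave_packet_S_seminorm_le[OF UNIV1 M LC growth]) auto
    also have "c * (T * K) = \<delta> / 2" using T K by (simp add: c_def)
    also have "ennreal (\<delta> / 2) < ennreal \<delta>" using pos by (simp add: ennreal_less_iff)
    finally have "S_seminorm (growth N \<mu>) 1 ?f < 1"
      using ball mem c t by (simp add: less_imp_le)
    then have "S_seminorm (growth N \<mu>) 1 ?f \<le> ennreal 1" by simp
    then have all: "\<bar>monomial \<alpha> x\<bar> * norm (multi_partial \<beta> ?f x) \<le> 1 * (1 ^ mi_abs (\<alpha> + \<beta>) * growth N \<mu> \<alpha> \<beta>)" for \<alpha> \<beta> x
      using growth_increasing_weights[OF N growth] \<mu>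
      by (subst (asm) S_seminorm_le_iff) (auto simp: increasing_weights_def)
    have "((\<lambda>x. of_real c * wave_packet t n x) has_vector_derivative of_real c * wave_packet t (Suc n) x) (at x)" for n x
      by (intro has_vector_derivative_mult_right wave_packet_has_derivative)
    note mp = multi_partial_lift_one_dim[OF UNIV1, of "\<lambda>n x. of_real c * wave_packet t n x", OF this]
    have "c * t ^ Suc p \<le> c * norm (wave_packet t (Suc p) 0)"
      using c t by (intro mult_left_mono wave_packet_at_0_ge) auto
    also have "\<dots> \<le> N \<mu> (vec (Suc p))"
      using all[of 0 0 "vec (Suc p)"] c
      by (simp add: mp monomial_one_dim[OF UNIV1] norm_mult N0)
    finally have "\<delta> / (2 * (T * K)) * ((h / 2) ^ Suc p * m ^ Suc p) \<le> N \<mu> (vec (Suc p))"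
      by (simp only: c_def t_def power_mult_distrib)
    moreover have mT: "m ^ Suc p = T * ?L (Suc p)"
      unfolding T_def using Lpos[of "Suc p"] by simp
    ultimately have "\<delta> / (2 * (T * K)) * ((h / 2) ^ Suc p * (T * ?L (Suc p))) \<le> N \<mu> (vec (Suc p))"
      unfolding mT by blast
    then have "(2 * K / \<delta>) * (2 / h) ^ Suc p * (\<delta> / (2 * (T * K)) * ((h / 2) ^ Suc p * (T * ?L (Suc p))))
        \<le> (2 * K / \<delta>) * (2 / h) ^ Suc p * N \<mu> (vec (Suc p))"
      using K pos by (intro mult_left_mono) auto
    moreover have "(2 * K / \<delta>) * (2 / h) ^ Suc p * (\<delta> / (2 * (T * K)) * ((h / 2) ^ Suc p * (T * ?L (Suc p)))) = ?L (Suc p)"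
      using K pos T by (simp add: power_divide del: power_Suc)
    ultimately show ?thesis by simp
  qed
  \<comment> \<open>The index \<open>0\<close> is covered by the normalization of the weights; for all others the
    constant prefactor is at most a geometric one.\<close>
  define C where "C = max 1 (2 * K / \<delta>) * max 1 (2 / h)"
  have "M \<kappa> \<alpha> \<le> C ^ mi_abs \<alpha> * N \<mu> \<alpha>" for \<alpha>
  proof -
    have \<alpha>: "\<alpha> = vec (mi_abs \<alpha>)"
      using vec_one_dim[OF UNIV1, of \<alpha>] mi_abs_one_dim[OF UNIV1, of \<alpha>] by simp
    show ?thesis
    proof (cases "mi_abs \<alpha>")
      case 0
      then have "\<alpha> = 0" using \<alpha> by (simp add: vec_eq_iff)
      then show ?thesis using M N \<mu> pos 0 by (simp add: weight_matrix_def)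
    next
      case (Suc p)
      have "max 1 (2 * K / \<delta>) ^ 1 \<le> max 1 (2 * K / \<delta>) ^ Suc p"
        by (intro power_increasing) auto
      then have "(2 * K / \<delta>) * (2 / h) ^ Suc p \<le> max 1 (2 * K / \<delta>) ^ Suc p * max 1 (2 / h) ^ Suc p"
        using pos by (intro mult_mono power_mono) auto
      then have "(2 * K / \<delta>) * (2 / h) ^ Suc p * N \<mu> (vec (Suc p)) \<le> C ^ Suc p * N \<mu> (vec (Suc p))"
        unfolding C_def power_mult_distrib using Npos by (intro mult_right_mono) (auto intro: less_imp_le)
      with main[of p] have "M \<kappa> (vec (Suc p)) \<le> C ^ Suc p * N \<mu> (vec (Suc p))"
        by (simp add: as_sequences_def del: power_Suc)
      then show ?thesis using \<alpha> Suc by metis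
    qed
  qed
  moreover have "C \<ge> 1" unfolding C_def by (rule mult_ge1_I) auto
  ultimately show "\<exists>\<kappa>>0. seq_preceq (M \<kappa>) (N \<mu>)"
    using pos unfolding seq_preceq_def by blast
qed

theorem theorem6p6:
  fixes M N :: "real \<Rightarrow> nat ^ 'd::finite \<Rightarrow> real"
  assumes "weight_matrix M" and "weight_matrix N"
  shows "\<forall>growth \<in> {joint_growth, separated_growth}.
    (beurling_preceq M N \<longrightarrow> continuously_included (growth M) (growth N)) \<and>
    (CARD('d) = 1 \<and>
     standard_log_convex (as_sequences M) \<and> standard_log_convex (as_sequences N) \<and>
     beurling_non_quasianalytic (as_sequences M) \<and>
     (\<forall>\<mu>>0. \<exists>\<kappa>>0. \<exists>A\<ge>1. \<forall>p.
        (as_sequences M \<kappa> p)\<^sup>2 \<le> A ^ p * as_sequences M \<mu> p) \<and>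
     continuously_included (growth M) (growth N)
     \<longrightarrow> beurling_preceq M N)"
  using beurling_preceq_imp_continuously_included[OF assms]
    continuously_included_imp_beurling_preceq[OF assms]
  by blast

end
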